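(* Let $\Pi$ be $\Pi_{\to}$ or $\Pi_{\rm all}$. Suppose that the data $\{Z_t\}_{t=1}^T$ are i.i.d. or exchangeable with respect to $\Pi$ under the null hypothesis and that $\hat u_t=g(Z_t,\hat\beta)$, where the estimator $\hat\beta=\hat\beta(\{Z_t\}_{t=1}^T)$ is invariant with respect to any permutation of the data. Then, under the null hypothesis, $\{\hat u_t\}_{t=1}^T$ is an exchangeable sequence and the permutation p-value $\hat p$ is unbiased in level: $$P(\hat p\le\alpha)\le\alpha.$$ Moreover, if $\{S(\hat u_\pi)\}_{\pi\in\Pi}$ has a continuous distribution, $$\alpha-\frac1{|\Pi|}\le P(\hat p\le\alpha).$$
   Context: $T=T_0+T_*$. $\Pi_{\rm all}$ is the set of all permutations of $\{1,\dots,T\}$; $\Pi_{\to}=\{\pi_0,\dots,\pi_{T-1}\}$ is the set of moving block permutations, with $\pi_j(i)=i+j$ if $i+j\le T$ and $\pi_j(i)=i+j-T$ otherwise. A finite sequence $\{W_t\}_{t=1}^T$ is exchangeable with respect to $\Pi$ if $\{W_{\pi(t)}\}_{t=1}^T$ has the same distribution as $\{W_t\}_{t=1}^T$ for every $\pi\in\Pi$. $\{Z_t\}$ denotes the data with the null hypothesis imposed (post-treatment outcomes of the treated unit are replaced by the counterfactual no-treatment values implied by the null), $g$ is a function, $\hat u=(\hat u_1,\dots,\hat u_T)'$, and $\hat u_\pi=(\hat u_{\pi(1)},\dots,\hat u_{\pi(T)})'$. The test statistic is $S(v)=\left(\frac1{\sqrt{T_*}}\sum_{t=T_0+1}^T|v_t|^q\right)^{1/q}$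 for $v\in\mathbb R^T$ and a fixed $q\ge1$. The p-value is $\hat p=1-\hat F(S(\hat u))$ with $\hat F(x)=\frac1{|\Pi|}\sum_{\pi\in\Pi}\mathbf 1\{S(\hat u_\pi)<x\}$, and $\alpha\in(0,1)$ is the nominal level. *)

theory Defs
  imports "HOL-Probability.Probability" "HOL-Combinatorics.Permutations"
begin

text \<open>
  Time runs over \<^term>\<open>{1..T}\<close>. Permutations are total functions on \<^typ>\<open>nat\<close> that are the
  identity off \<^term>\<open>{1..T}\<close>, so that distinct permutations are distinct functions and
  cardinalities of sets of permutations come out right.
\<close>

definition all_perms :: "nat \<Rightarrow> (nat \<Rightarrow> nat) set" where
  "all_perms T = {\<pi>. \<pi> permutes {1..T}}"

definition moving_block_perm :: "nat \<Rightarrow> nat \<Rightarrow> nat \<Rightarrow> nat" where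
  "moving_block_perm T j i =
     (if i \<in> {1..T} then (if i + j \<le> T then i + j else i + j - T) else i)"

definition moving_block_perms :: "nat \<Rightarrow> (nat \<Rightarrow> nat) set" where
  "moving_block_perms T = moving_block_perm T ` {0..<T}"

definition trajectory :: "nat \<Rightarrow> (nat \<Rightarrow> 'w \<Rightarrow> 'a) \<Rightarrow> 'w \<Rightarrow> nat \<Rightarrow> 'a" where
  "trajectory T W \<omega> = (\<lambda>t\<in>{1..T}. W t \<omega>)"

definition exchangeable_wrt ::
    "'w measure \<Rightarrow> 'a measure \<Rightarrow> nat \<Rightarrow> (nat \<Rightarrow> nat) set \<Rightarrow> (nat \<Rightarrow> 'w \<Rightarrow> 'a) \<Rightarrow> bool" where
  "exchangeable_wrt M N T Perms W \<longleftrightarrow>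
     (\<forall>\<pi>\<in>Perms. distr M (\<Pi>\<^sub>M t\<in>{1..T}. N) (trajectory T (\<lambda>t. W (\<pi> t)))
           = distr M (\<Pi>\<^sub>M t\<in>{1..T}. N) (trajectory T W))"

definition iid_sequence ::
    "'w measure \<Rightarrow> 'a measure \<Rightarrow> nat \<Rightarrow> (nat \<Rightarrow> 'w \<Rightarrow> 'a) \<Rightarrow> bool" where
  "iid_sequence M N T W \<longleftrightarrow>
     prob_space.indep_vars M (\<lambda>_. N) W {1..T} \<and>
     (\<forall>s\<in>{1..T}. \<forall>t\<in>{1..T}. distr M N (W s) = distr M N (W t))"

definition permutation_invariant ::
    "'a measure \<Rightarrow> nat \<Rightarrow> ((nat \<Rightarrow> 'a) \<Rightarrow> 'b) \<Rightarrow> bool" where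
  "permutation_invariant N T b \<longleftrightarrow>
     (\<forall>z\<in>space (\<Pi>\<^sub>M t\<in>{1..T}. N). \<forall>\<pi>\<in>all_perms T. b (\<lambda>t\<in>{1..T}. z (\<pi> t)) = b z)"

definition test_stat :: "nat \<Rightarrow> nat \<Rightarrow> real \<Rightarrow> (nat \<Rightarrow> real) \<Rightarrow> real" where
  "test_stat T0 Ts q v =
     ((1 / sqrt (real Ts)) * (\<Sum>t=T0+1..T0+Ts. \<bar>v t\<bar> powr q)) powr (1 / q)"

definition perm_cdf ::
    "(nat \<Rightarrow> nat) set \<Rightarrow> ((nat \<Rightarrow> real) \<Rightarrow> real) \<Rightarrow> (nat \<Rightarrow> real) \<Rightarrow> real \<Rightarrow> real" where
  "perm_cdf Perms S u x = (1 / real (card Perms)) * (\<Sum>\<pi>\<in>Perms. of_bool (S (u \<circ> \<pi>) < x))"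

definition perm_pvalue ::
    "(nat \<Rightarrow> nat) set \<Rightarrow> ((nat \<Rightarrow> real) \<Rightarrow> real) \<Rightarrow> (nat \<Rightarrow> real) \<Rightarrow> real" where
  "perm_pvalue Perms S u = 1 - perm_cdf Perms S u (S u)"

text \<open>
  A family of real random variables has a continuous distribution if its members, and any two
  distinct members jointly, have a law that is absolutely continuous with respect to Lebesgue
  measure. A joint density of the whole family implies this, but would be too much to ask of
  block sums: with \<open>T = 4\<close> and windows of length 2, the four circular window sums satisfy
  \<open>(a + b) + (c + d) = (b + c) + (d + a)\<close>, so their joint law is always singular.
  Atomless marginals alone (equivalently, a continuous joint distribution function) are not
  enough for rank arguments, because they allow two members to coincide almost surely.
\<close>

definition continuous_family ::
    "'w measure \<Rightarrow> 'i set \<Rightarrow> ('i \<Rightarrow> 'w \<Rightarrow> real) \<Rightarrow> bool" where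
  "continuous_family M I X \<longleftrightarrow>
     (\<forall>i\<in>I. absolutely_continuous lborel (distr M borel (X i))) \<and>
     (\<forall>i\<in>I. \<forall>j\<in>I. i \<noteq> j \<longrightarrow>
        absolutely_continuous lborel (distr M borel (\<lambda>\<omega>. (X i \<omega>, X j \<omega>))))"

end

theory Submission
  imports Defs
begin

text \<open>
  Both families of permutations are closed under composition, so the p-value of the
  data permuted by \<open>\<sigma>\<close> is the normalised upper rank of \<open>S (u \<circ> \<sigma>)\<close> within one and the same
  orbit \<open>{S (u \<circ> \<pi>)}\<close>. At most \<open>\<alpha> n\<close> members of a family of \<open>n\<close> reals have upper rank at most
  \<open>\<alpha> n\<close>, and at least \<open>\<alpha> n - 1\<close> do if there are no ties. By exchangeability all permuted p-values
  have the same law, so averaging this count over the orbit bounds the rejection probability.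
\<close>

section \<open>Ranks in a finite family of reals\<close>

text \<open>A member with the smallest value among those of upper rank at most \<open>c\<close> has
  all of them in its own upper set, and that set has at most \<open>c\<close> elements. Ties do no
  harm, since they only raise upper ranks.\<close>

lemma card_upper_rank_le:
  fixes s :: "'i \<Rightarrow> 'a::linorder" and c :: real
  assumes "finite G" and "0 \<le> c"
  shows "real (card {\<sigma>\<in>G. real (card {\<pi>\<in>G. s \<sigma> \<le> s \<pi>}) \<le> c}) \<le> c"
proof (cases "{\<sigma>\<in>G. real (card {\<pi>\<in>G. s \<sigma> \<le> s \<pi>}) \<le> c} = {}")
  case True
  with assms show ?thesis by (metis card.empty of_nat_0)
next
  case False
  define A where "A = {\<sigma>\<in>G. real (card {\<pi>\<in>G. s \<sigma> \<le> s \<pi>}) \<le> c}"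
  have fin: "finite A" and ne: "A \<noteq> {}"
    using assms False by (simp_all add: A_def)
  define m where "m = arg_min_on s A"
  have m: "m \<in> A" unfolding m_def using arg_min_if_finite(1)[OF fin ne] .
  have "A \<subseteq> {\<pi>\<in>G. s m \<le> s \<pi>}"
    using arg_min_least[OF fin ne, of _ s] by (auto simp: m_def A_def)
  then have "card A \<le> card {\<pi>\<in>G. s m \<le> s \<pi>}"
    using assms(1) by (intro card_mono) auto
  with m show ?thesis by (simp add: A_def)
qed

text \<open>Without ties the upper rank is a bijection from \<open>G\<close> onto
  \<open>{1..card G}\<close>, so every integer rank up to \<open>c\<close> is attained exactly once.
  The loss of 1 is the cost of rounding \<open>c\<close> down.\<close>

lemma card_upper_rank_ge:
  fixes s :: "'i \<Rightarrow> 'a::linorder" and c :: real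
  assumes "finite G" and "inj_on s G" and "0 \<le> c" and "c \<le> real (card G)"
  shows "c - 1 \<le> real (card {\<sigma>\<in>G. real (card {\<pi>\<in>G. s \<sigma> \<le> s \<pi>}) \<le> c})"
proof -
  define r where "r \<sigma> = card {\<pi>\<in>G. s \<sigma> \<le> s \<pi>}" for \<sigma>
  \<comment> \<open>The inclusion of upper sets is strict because \<sigma> lies in its own upper set
    but not in that of \<tau>.\<close>
  have less: "r \<tau> < r \<sigma>" if "\<sigma> \<in> G" "\<tau> \<in> G" "s \<sigma> < s \<tau>" for \<sigma> \<tau>
    unfolding r_def using assms(1) that
    by (intro psubset_card_mono psubsetI) (auto simp: set_eq_iff intro!: exI[of _ \<sigma>])
  have inj: "inj_on r G"
  proof (rule inj_onI)
    fix \<sigma> \<tau> assume *: "\<sigma> \<in> G" "\<tau> \<in> G" "r \<sigma> = r \<tau>"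
    then have "s \<sigma> = s \<tau>" using less[of \<sigma> \<tau>] less[of \<tau> \<sigma>] by (metis less_irrefl neqE)
    with * assms(2) show "\<sigma> = \<tau>" by (auto dest: inj_onD)
  qed
  have "r \<sigma> \<in> {1..card G}" if "\<sigma> \<in> G" for \<sigma>
  proof -
    have "\<sigma> \<in> {\<pi>\<in>G. s \<sigma> \<le> s \<pi>}" using that by simp
    then have "r \<sigma> > 0" unfolding r_def using assms(1) by (auto simp: card_gt_0_iff)
    moreover have "r \<sigma> \<le> card G" unfolding r_def using assms(1) by (intro card_mono) auto
    ultimately show ?thesis by simp
  qed
  then have img: "r ` G = {1..card G}"
    using inj by (intro card_subset_eq) (auto simp: card_image)
  define k where "k = nat \<lfloor>c\<rfloor>"
  have k: "real k \<le> c" "c - 1 \<le> real k"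
    using assms(3) unfolding k_def by linarith+
  then have "k \<le> card G" using assms(4) by linarith
  then have "{1..k} \<subseteq> r ` {\<sigma>\<in>G. real (r \<sigma>) \<le> c}"
  proof (intro subsetI)
    fix i assume i: "i \<in> {1..k}"
    with \<open>k \<le> card G\<close> img have "i \<in> r ` G" by auto
    with i k(1) show "i \<in> r ` {\<sigma>\<in>G. real (r \<sigma>) \<le> c}" by force
  qed
  then have "card {1..k} \<le> card {\<sigma>\<in>G. real (r \<sigma>) \<le> c}"
    using assms(1) by (intro surj_card_le) auto
  with k(2) show ?thesis by (simp add: r_def)
qed

text \<open>Linearity of expectation, applied to the count written as a sum of indicators.
  Integrability is recorded as well because the later comparisons of the integral with constants
  require it.\<close>

lemma (in prob_space) sum_prob_eq_expectation_card:
  assumes "finite I" and "\<And>i. i \<in> I \<Longrightarrow> {\<omega>\<in>space M. P i \<omega>} \<in> events"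
  shows "(\<Sum>i\<in>I. prob {\<omega>\<in>space M. P i \<omega>}) = expectation (\<lambda>\<omega>. real (card {i\<in>I. P i \<omega>}))"
    and "integrable M (\<lambda>\<omega>. real (card {i\<in>I. P i \<omega>}))"
proof -
  let ?f = "\<lambda>\<omega>. \<Sum>i\<in>I. indicator {\<omega>\<in>space M. P i \<omega>} \<omega> :: real"
  have card: "real (card {i\<in>I. P i \<omega>}) = ?f \<omega>" if "\<omega> \<in> space M" for \<omega>
  proof -
    have "?f \<omega> = (\<Sum>i\<in>I. if P i \<omega> then 1 else 0)"
      using that by (intro sum.cong) (auto simp: indicator_def)
    also have "\<dots> = real (card {i\<in>I. P i \<omega>})"
      using assms(1) by (simp add: sum.If_cases Int_def)
    finally show ?thesis by simp
  qed
  have int: "integrable M (indicator {\<omega>\<in>space M. P i \<omega>} :: _ \<Rightarrow> real)" if "i \<in> I" for i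
    using assms(2)[OF that] by (intro integrable_real_indicator) (auto simp: emeasure_eq_measure)
  have "integrable M ?f" using int by (intro Bochner_Integration.integrable_sum)
  then show "integrable M (\<lambda>\<omega>. real (card {i\<in>I. P i \<omega>}))"
    using card by (subst Bochner_Integration.integrable_cong[OF refl]) auto
  have "expectation (\<lambda>\<omega>. real (card {i\<in>I. P i \<omega>})) = expectation ?f"
    using card by (intro Bochner_Integration.integral_cong) auto
  also have "\<dots> = (\<Sum>i\<in>I. prob {\<omega>\<in>space M. P i \<omega>})"
    using int assms(2) by (subst Bochner_Integration.integral_sum) (auto intro!: sum.cong)
  finally show "(\<Sum>i\<in>I. prob {\<omega>\<in>space M. P i \<omega>}) = expectation (\<lambda>\<omega>. real (card {i\<in>I. P i \<omega>}))"
    by simp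
qed

section \<open>Composition-closed sets of permutations\<close>

text \<open>Renumbering time from 0 turns a block move into addition modulo \<open>T\<close>, so
  that composition and inverses become modular arithmetic.\<close>

lemma moving_block_perm_eq_mod:
  assumes "i \<in> {1..T}" and "j < T"
  shows "moving_block_perm T j i = Suc ((i - 1 + j) mod T)"
proof (cases "i + j \<le> T")
  case True
  with assms show ?thesis by (simp add: moving_block_perm_def)
next
  case False
  \<comment> \<open>One subtraction of \<open>T\<close> reduces the sum: here
    \<open>i - 1 + j\<close> is at least \<open>T\<close>, and it is below
    \<open>2 * T\<close>.\<close>
  then have "(i - 1 + j) mod T = (i - 1 + j - T) mod T"
    using assms by (simp add: le_mod_geq)
  also have "\<dots> = i - 1 + j - T" using assms by (intro mod_less) auto
  finally show ?thesis using False assms by (simp add: moving_block_perm_def)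
qed

lemma moving_block_perm_comp:
  assumes "j < T" and "k < T"
  shows "moving_block_perm T j \<circ> moving_block_perm T k = moving_block_perm T ((j + k) mod T)"
proof
  fix i
  show "(moving_block_perm T j \<circ> moving_block_perm T k) i = moving_block_perm T ((j + k) mod T) i"
  proof (cases "i \<in> {1..T}")
    case True
    \<comment> \<open>The shifted index is again in range, so the modular formula can be applied a
      second time.\<close>
    have "Suc ((i - 1 + k) mod T) \<in> {1..T}"
      using assms by (simp add: Suc_le_eq)
    then have "(moving_block_perm T j \<circ> moving_block_perm T k) i = Suc (((i - 1 + k) mod T + j) mod T)"
      using True assms by (simp only: comp_apply moving_block_perm_eq_mod diff_Suc_1)
    also have "((i - 1 + k) mod T + j) mod T = (i - 1 + (j + k) mod T) mod T"
      by (simp only: mod_add_left_eq mod_add_right_eq ac_simps)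
    also have "Suc \<dots> = moving_block_perm T ((j + k) mod T) i"
      using True assms by (simp only: moving_block_perm_eq_mod mod_less_divisor)
    finally show ?thesis .
  qed (auto simp: moving_block_perm_def)
qed

lemma moving_block_perm_0: "moving_block_perm T 0 = id"
  by (auto simp: moving_block_perm_def)

lemma moving_block_perm_permutes:
  assumes "j < T"
  shows "moving_block_perm T j permutes {1..T}"
proof -
  \<comment> \<open>The inverse shift; the outer \<open>mod T\<close> sends the case
    \<open>j = 0\<close> to 0 instead of \<open>T\<close>, which keeps \<open>?k\<close> below
    \<open>T\<close>.\<close>
  let ?k = "(T - j) mod T"
  have "?k < T" using assms by simp
  moreover have "(j + ?k) mod T = 0" "(?k + j) mod T = 0"
    using assms by (simp_all add: mod_add_right_eq mod_add_left_eq)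
  ultimately have "moving_block_perm T j \<circ> moving_block_perm T ?k = id"
      "moving_block_perm T ?k \<circ> moving_block_perm T j = id"
    using assms by (simp_all only: moving_block_perm_comp moving_block_perm_0)
  then have "bij (moving_block_perm T j)" using o_bij by blast
  then show ?thesis
    unfolding permutes_def bij_iff by (auto simp: moving_block_perm_def)
qed

lemma moving_block_perms_subset: "moving_block_perms T \<subseteq> all_perms T"
  using moving_block_perm_permutes by (auto simp: moving_block_perms_def all_perms_def)

lemma finite_all_perms: "finite (all_perms T)"
  by (simp add: all_perms_def finite_permutations)

lemma all_perms_in_range: "\<pi> \<in> all_perms T \<Longrightarrow> t \<in> {1..T} \<Longrightarrow> \<pi> t \<in> {1..T}"
  unfolding all_perms_def by (metis mem_Collect_eq permutes_in_image)

lemma moving_block_perms_comp_closed: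
  assumes "\<sigma> \<in> moving_block_perms T" and "\<pi> \<in> moving_block_perms T"
  shows "\<sigma> \<circ> \<pi> \<in> moving_block_perms T"
  using assms by (force simp: moving_block_perms_def moving_block_perm_comp)

lemma all_perms_comp_closed: "\<sigma> \<in> all_perms T \<Longrightarrow> \<pi> \<in> all_perms T \<Longrightarrow> \<sigma> \<circ> \<pi> \<in> all_perms T"
  by (simp add: all_perms_def permutes_compose)

text \<open>Left translation is injective because \<sigma> is, and finiteness of \<open>P\<close>
  makes it surjective. Closure under composition thus does the work of a group structure.\<close>

lemma bij_betw_comp_left:
  assumes "P \<subseteq> all_perms T" and "\<And>\<sigma> \<pi>. \<sigma> \<in> P \<Longrightarrow> \<pi> \<in> P \<Longrightarrow> \<sigma> \<circ> \<pi> \<in> P" and "\<sigma> \<in> P"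
  shows "bij_betw ((\<circ>) \<sigma>) P P"
proof -
  have "inj \<sigma>" using assms by (auto simp: all_perms_def intro: permutes_inj)
  then have "inj_on ((\<circ>) \<sigma>) P" by (intro inj_onI) (simp add: fun.inj_map_strong fun_eq_iff inj_eq)
  moreover have "(\<circ>) \<sigma> ` P \<subseteq> P" using assms by auto
  moreover have "finite P" using assms(1) finite_all_perms finite_subset by blast
  ultimately show ?thesis by (simp add: bij_betw_def endo_inj_surj)
qed

section \<open>The permutation p-value as a rank\<close>

text \<open>The empirical distribution function counts strict inequalities, so its complement counts
  the weak ones: the p-value is the upper rank of \<open>S v\<close>, ties included, divided by
  \<open>card P\<close>.\<close>

lemma perm_pvalue_le_iff:
  assumes "finite P" and "P \<noteq> {}"
  shows "perm_pvalue P S v \<le> \<alpha> \<longleftrightarrow> real (card {\<pi>\<in>P. S v \<le> S (v \<circ> \<pi>)}) \<le> \<alpha> * real (card P)"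
proof -
  have n: "real (card P) > 0" using assms by (simp add: card_gt_0_iff)
  have "card {\<pi>\<in>P. S v \<le> S (v \<circ> \<pi>)} + card {\<pi>\<in>P. S (v \<circ> \<pi>) < S v} = card P"
    using assms(1) by (subst card_Un_disjoint[symmetric]) (auto intro!: arg_cong[where f = card])
  moreover have "(\<Sum>\<pi>\<in>P. of_bool (S (v \<circ> \<pi>) < S v)) = real (card {\<pi>\<in>P. S (v \<circ> \<pi>) < S v})"
    using assms(1) by (simp add: of_bool_def sum.If_cases Int_def)
  ultimately have "perm_pvalue P S v = real (card {\<pi>\<in>P. S v \<le> S (v \<circ> \<pi>)}) / real (card P)"
    using n by (simp add: perm_pvalue_def perm_cdf_def field_simps flip: of_nat_add)
  with n show ?thesis by (simp add: pos_divide_le_eq)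
qed

text \<open>Replacing \<pi> by \<open>\<sigma> \<circ> \<pi>\<close> merely reindexes
  \<open>P\<close>. Hence the p-values of all permuted vectors are ranks in one common family, which
  is what allows counting over \<sigma>.\<close>

lemma perm_pvalue_comp_le_iff:
  assumes "finite P" and "bij_betw ((\<circ>) \<sigma>) P P" and "\<sigma> \<in> P"
  shows "perm_pvalue P S (v \<circ> \<sigma>) \<le> \<alpha> \<longleftrightarrow>
    real (card {\<pi>\<in>P. S (v \<circ> \<sigma>) \<le> S (v \<circ> \<pi>)}) \<le> \<alpha> * real (card P)"
proof -
  have "bij_betw ((\<circ>) \<sigma>) {\<pi>\<in>P. S (v \<circ> \<sigma>) \<le> S (v \<circ> (\<sigma> \<circ> \<pi>))} {\<pi>\<in>P. S (v \<circ> \<sigma>) \<le> S (v \<circ> \<pi>)}"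
    using assms(2) by (auto simp: bij_betw_def inj_on_def image_iff)
  then have "card {\<pi>\<in>P. S (v \<circ> \<sigma>) \<le> S (v \<circ> (\<sigma> \<circ> \<pi>))} = card {\<pi>\<in>P. S (v \<circ> \<sigma>) \<le> S (v \<circ> \<pi>)}"
    by (rule bij_betw_same_card)
  moreover have "P \<noteq> {}" using assms(3) by auto
  ultimately show ?thesis using perm_pvalue_le_iff[OF assms(1), of S "v \<circ> \<sigma>" \<alpha>]
    by (simp add: comp_assoc)
qed

lemma test_stat_cong:
  assumes "\<And>t. t \<in> {1..T0 + Ts} \<Longrightarrow> v t = w t"
  shows "test_stat T0 Ts q v = test_stat T0 Ts q w"
  using assms by (auto simp: test_stat_def intro!: arg_cong2[where f = "(powr)"] sum.cong)

text \<open>This permits replacing a residual path by its \<open>trajectory\<close>, which agrees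
  with it on the time range and is \<open>undefined\<close> elsewhere.\<close>

lemma perm_pvalue_test_stat_cong:
  assumes "P \<subseteq> all_perms (T0 + Ts)" and "\<And>t. t \<in> {1..T0 + Ts} \<Longrightarrow> v t = w t"
  shows "perm_pvalue P (test_stat T0 Ts q) v = perm_pvalue P (test_stat T0 Ts q) w"
proof -
  have "test_stat T0 Ts q (v \<circ> \<pi>) = test_stat T0 Ts q (w \<circ> \<pi>)" if "\<pi> \<in> P" for \<pi>
    unfolding comp_def using assms all_perms_in_range that by (intro test_stat_cong) blast
  moreover have "test_stat T0 Ts q v = test_stat T0 Ts q w"
    using assms(2) by (rule test_stat_cong)
  ultimately show ?thesis by (simp add: perm_pvalue_def perm_cdf_def)
qed

lemma measurable_test_stat:
  assumes "\<And>t. t \<in> {1..T0 + Ts} \<Longrightarrow> (\<lambda>x. f x t) \<in> borel_measurable M"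
  shows "(\<lambda>x. test_stat T0 Ts q (f x)) \<in> borel_measurable M"
proof -
  have [measurable]: "(\<lambda>x. f x t) \<in> borel_measurable M" if "t \<in> {T0+1..T0+Ts}" for t
    using that assms by auto
  show ?thesis unfolding test_stat_def by measurable
qed

lemma measurable_perm_pvalue:
  assumes "P \<subseteq> all_perms (T0 + Ts)"
    and "\<And>t. t \<in> {1..T0 + Ts} \<Longrightarrow> (\<lambda>x. f x t) \<in> borel_measurable M"
  shows "(\<lambda>x. perm_pvalue P (test_stat T0 Ts q) (f x)) \<in> borel_measurable M"
proof -
  have [measurable]: "(\<lambda>x. test_stat T0 Ts q (f x \<circ> \<pi>)) \<in> borel_measurable M" if "\<pi> \<in> P" for \<pi>
    unfolding comp_def using assms all_perms_in_range that by (intro measurable_test_stat) blast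
  have [measurable]: "(\<lambda>x. test_stat T0 Ts q (f x)) \<in> borel_measurable M"
    using assms(2) by (rule measurable_test_stat)
  show ?thesis unfolding perm_pvalue_def perm_cdf_def by measurable
qed

section \<open>Exchangeability\<close>

lemma measurable_trajectory:
  assumes "\<And>t. t \<in> {1..T} \<Longrightarrow> W t \<in> M \<rightarrow>\<^sub>M N"
  shows "trajectory T W \<in> M \<rightarrow>\<^sub>M (\<Pi>\<^sub>M t\<in>{1..T}. N)"
  unfolding trajectory_def[abs_def] using assms by (intro measurable_restrict)

text \<open>The law of the path is a product of identical factors, and such a product is unchanged
  when its coordinates are permuted.\<close>

lemma iid_sequence_imp_exchangeable:
  assumes "prob_space M" and "iid_sequence M N T W" and "P \<subseteq> all_perms T"
    and W: "\<And>t. t \<in> {1..T} \<Longrightarrow> W t \<in> M \<rightarrow>\<^sub>M N"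
  shows "exchangeable_wrt M N T P W"
proof (cases "T = 0")
  case True
  \<comment> \<open>With no time points all trajectories coincide. The case is split off because
    \<open>W 1\<close> supplies the common marginal law in the other one.\<close>
  then have "trajectory T V = (\<lambda>\<omega> t. undefined)" for V :: "nat \<Rightarrow> 'a \<Rightarrow> 'b"
    by (auto simp: trajectory_def fun_eq_iff)
  then show ?thesis by (simp add: exchangeable_wrt_def)
next
  case False
  interpret prob_space M by fact
  let ?N = "\<Pi>\<^sub>M t\<in>{1..T}. N"
  define Q where "Q = distr M N (W 1)"
  have Q: "prob_space Q" "sets Q = sets N"
    using W[of 1] False by (simp_all add: Q_def prob_space_distr)
  have tW: "trajectory T W \<in> M \<rightarrow>\<^sub>M ?N" using W by (rule measurable_trajectory)
  have "distr M ?N (trajectory T W) = (\<Pi>\<^sub>M t\<in>{1..T}. distr M N (W t))"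
    using assms(2) False indep_vars_iff_distr_eq_PiM'[of "{1..T}" W "\<lambda>_. N", OF _ W]
    unfolding iid_sequence_def trajectory_def[abs_def] by auto
  also have "\<dots> = (\<Pi>\<^sub>M t\<in>{1..T}. Q)"
  proof (rule PiM_cong[OF refl])
    fix t assume "t \<in> {1..T}"
    moreover have "1 \<in> {1..T}" using False by simp
    ultimately show "distr M N (W t) = Q"
      using assms(2) unfolding iid_sequence_def Q_def by blast
  qed
  finally have law: "distr M ?N (trajectory T W) = (\<Pi>\<^sub>M t\<in>{1..T}. Q)" .
  have "distr M ?N (trajectory T (\<lambda>t. W (\<pi> t))) = (\<Pi>\<^sub>M t\<in>{1..T}. Q)" if \<pi>: "\<pi> \<in> all_perms T" for \<pi>
  proof -
    note in_range = all_perms_in_range[OF \<pi>]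
    let ?r = "\<lambda>z. \<lambda>t\<in>{1..T}. z (\<pi> t)"
    have r: "?r \<in> ?N \<rightarrow>\<^sub>M ?N"
      by (intro measurable_restrict measurable_component_singleton in_range)
    \<comment> \<open>Permuting time is a measurable map on path space, so the permuted law is an
      image of the product law.\<close>
    have "trajectory T (\<lambda>t. W (\<pi> t)) = ?r \<circ> trajectory T W"
      using in_range by (intro ext) (simp add: trajectory_def cong: restrict_cong)
    then have "distr M ?N (trajectory T (\<lambda>t. W (\<pi> t))) = distr (\<Pi>\<^sub>M t\<in>{1..T}. Q) ?N ?r"
      by (simp only: distr_distr[OF r tW, symmetric] law)
    \<comment> \<open>\<open>Q\<close> and \<open>N\<close> have the same measurable sets, so the
      target can be changed to the form that the reindexing rule for products expects.\<close>
    also have "\<dots> = distr (\<Pi>\<^sub>M t\<in>{1..T}. Q) (\<Pi>\<^sub>M t\<in>{1..T}. Q) ?r"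
      using Q(2) by (intro distr_cong sets_PiM_cong) auto
    also have "\<dots> = (\<Pi>\<^sub>M t\<in>{1..T}. Q)"
      using \<pi> Q(1) in_range
      by (intro distr_PiM_reindex) (auto simp: all_perms_def intro: permutes_inj_on)
    finally show ?thesis .
  qed
  with law assms(3) show ?thesis by (auto simp: exchangeable_wrt_def)
qed

text \<open>The residual path is a fixed measurable function \<open>G\<close> of the data path.
  Invariance of the estimator makes \<open>G\<close> commute with permutations of time, so equality
  of laws passes from data to residuals.\<close>

lemma exchangeable_wrt_residuals:
  assumes exch: "exchangeable_wrt M N T P Z" and P: "P \<subseteq> all_perms T"
    and Z: "\<And>t. t \<in> {1..T} \<Longrightarrow> Z t \<in> M \<rightarrow>\<^sub>M N"
    and \<beta>: "\<beta> \<in> (\<Pi>\<^sub>M t\<in>{1..T}. N) \<rightarrow>\<^sub>M B" "permutation_invariant N T \<beta>"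
    and g: "g \<in> N \<Otimes>\<^sub>M B \<rightarrow>\<^sub>M K"
    and u: "\<And>t \<omega>. t \<in> {1..T} \<Longrightarrow> \<omega> \<in> space M \<Longrightarrow> u t \<omega> = g (Z t \<omega>, \<beta> (trajectory T Z \<omega>))"
  shows "exchangeable_wrt M K T P u"
proof -
  let ?N = "\<Pi>\<^sub>M t\<in>{1..T}. N" and ?K = "\<Pi>\<^sub>M t\<in>{1..T}. K"
  define G where "G z = (\<lambda>t\<in>{1..T}. g (z t, \<beta> z))" for z
  have G: "G \<in> ?N \<rightarrow>\<^sub>M ?K"
    unfolding G_def using \<beta>(1) g by measurable
  have tZ: "trajectory T Z \<in> M \<rightarrow>\<^sub>M ?N" using Z by (rule measurable_trajectory)
  have G_perm: "trajectory T (\<lambda>t. u (\<pi> t)) \<omega> = G (trajectory T (\<lambda>t. Z (\<pi> t)) \<omega>)"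
    if \<pi>: "\<pi> \<in> all_perms T" and \<omega>: "\<omega> \<in> space M" for \<pi> \<omega>
  proof -
    have "trajectory T (\<lambda>t. Z (\<pi> t)) \<omega> = (\<lambda>t\<in>{1..T}. trajectory T Z \<omega> (\<pi> t))"
      using all_perms_in_range[OF \<pi>] by (auto simp: trajectory_def restrict_def)
    then have "\<beta> (trajectory T (\<lambda>t. Z (\<pi> t)) \<omega>) = \<beta> (trajectory T Z \<omega>)"
      using \<beta>(2) \<pi> measurable_space[OF tZ \<omega>] by (simp add: permutation_invariant_def)
    then show ?thesis
      using u[OF all_perms_in_range[OF \<pi>] \<omega>] by (auto simp: G_def trajectory_def restrict_def)
  qed
  have law: "distr M ?K (trajectory T (\<lambda>t. u (\<pi> t)))
      = distr (distr M ?N (trajectory T (\<lambda>t. Z (\<pi> t)))) ?K G" if \<pi>: "\<pi> \<in> all_perms T" for \<pi>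
  proof -
    have "trajectory T (\<lambda>t. Z (\<pi> t)) \<in> M \<rightarrow>\<^sub>M ?N"
      using Z all_perms_in_range[OF \<pi>] by (intro measurable_trajectory) blast
    then show ?thesis
      using G G_perm[OF \<pi>] by (simp add: distr_distr comp_def cong: distr_cong)
  qed
  \<comment> \<open>The instance \<open>id\<close> expresses the law of the unpermuted residuals
    through \<open>G\<close> too.\<close>
  have "id \<in> all_perms T" by (simp add: all_perms_def permutes_id)
  with law[of id] law P exch show ?thesis by (auto simp: exchangeable_wrt_def)
qed

text \<open>Rejection is the event that the path lies in a fixed measurable set \<open>D\<close>, so
  its probability depends only on the law of the path.\<close>

lemma prob_perm_pvalue_exchangeable:
  assumes exch: "exchangeable_wrt M borel (T0 + Ts) P u" and P: "P \<subseteq> all_perms (T0 + Ts)"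
    and u: "\<And>t. t \<in> {1..T0 + Ts} \<Longrightarrow> u t \<in> borel_measurable M" and "\<sigma> \<in> P"
  shows "measure M {\<omega>\<in>space M. perm_pvalue P (test_stat T0 Ts q) ((\<lambda>t. u t \<omega>) \<circ> \<sigma>) \<le> \<alpha>}
    = measure M {\<omega>\<in>space M. perm_pvalue P (test_stat T0 Ts q) (\<lambda>t. u t \<omega>) \<le> \<alpha>}"
proof -
  let ?T = "T0 + Ts" and ?p = "perm_pvalue P (test_stat T0 Ts q)"
  let ?K = "\<Pi>\<^sub>M t\<in>{1..?T}. (borel :: real measure)"
  define D where "D = {v\<in>space ?K. ?p v \<le> \<alpha>}"
  have [measurable]: "?p \<in> borel_measurable ?K"
    using P by (intro measurable_perm_pvalue[where f = "\<lambda>x. x"]) auto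
  have D: "D \<in> sets ?K" unfolding D_def by measurable
  \<comment> \<open>Stated for an arbitrary process \<open>W\<close> in order to be used twice, for
    the permuted residuals and for the original ones.\<close>
  have eq: "measure M {\<omega>\<in>space M. ?p (\<lambda>t. W t \<omega>) \<le> \<alpha>} = measure (distr M ?K (trajectory ?T W)) D"
    if W: "\<And>t. t \<in> {1..?T} \<Longrightarrow> W t \<in> borel_measurable M" for W
  proof -
    have tW: "trajectory ?T W \<in> M \<rightarrow>\<^sub>M ?K" using W by (rule measurable_trajectory)
    have "?p (\<lambda>t. W t \<omega>) = ?p (trajectory ?T W \<omega>)" for \<omega>
      using P by (intro perm_pvalue_test_stat_cong) (auto simp: trajectory_def)
    then have "{\<omega>\<in>space M. ?p (\<lambda>t. W t \<omega>) \<le> \<alpha>} = trajectory ?T W -` D \<inter> space M"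
      using measurable_space[OF tW] by (auto simp: D_def)
    then show ?thesis using tW D by (simp add: measure_distr)
  qed
  have "u (\<sigma> t) \<in> borel_measurable M" if "t \<in> {1..?T}" for t
    using that u all_perms_in_range P \<open>\<sigma> \<in> P\<close> by blast
  with eq[of "\<lambda>t. u (\<sigma> t)"] eq[of u] u exch \<open>\<sigma> \<in> P\<close> show ?thesis
    by (simp add: exchangeable_wrt_def comp_def)
qed

section \<open>Ties\<close>

text \<open>The diagonal is the hyperplane orthogonal to \<open>(1, -1)\<close>, hence
  negligible.\<close>

lemma null_sets_diagonal: "{p :: real \<times> real. fst p = snd p} \<in> null_sets lborel"
proof -
  have "{p :: real \<times> real. fst p = snd p} = {x. (1, -1) \<bullet> x = 0}"
    by (auto simp: inner_prod_def)
  moreover have "negligible {x :: real \<times> real. (1, -1) \<bullet> x = 0}"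
    by (intro negligible_hyperplane) (auto simp: zero_prod_def)
  ultimately have "{p :: real \<times> real. fst p = snd p} \<in> null_sets lebesgue"
    by (simp add: negligible_iff_null_sets)
  \<comment> \<open>Negligibility concerns the completed measure; as the diagonal is closed, hence
    Borel, it is also null for \<open>lborel\<close>.\<close>
  moreover have "{p :: real \<times> real. fst p = snd p} \<in> sets lborel"
    by (simp add: borel_closed closed_Collect_eq continuous_on_fst continuous_on_snd)
  ultimately show ?thesis using null_sets_completion_iff by blast
qed

text \<open>A tie between two members puts their pair on the diagonal, which absolute continuity
  makes a null event. There are only finitely many pairs.\<close>

lemma continuous_family_AE_inj_on:
  assumes "continuous_family M I X" and "finite I"
    and [measurable]: "\<And>i. i \<in> I \<Longrightarrow> X i \<in> borel_measurable M"
  shows "AE \<omega> in M. inj_on (\<lambda>i. X i \<omega>) I"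
proof -
  have "AE \<omega> in M. X i \<omega> \<noteq> X j \<omega>" if ij: "i \<in> I" "j \<in> I" "i \<noteq> j" for i j
  proof -
    have [measurable]: "X i \<in> borel_measurable M" "X j \<in> borel_measurable M"
      using ij by auto
    have "{p :: real \<times> real. fst p = snd p} \<in> null_sets (distr M borel (\<lambda>\<omega>. (X i \<omega>, X j \<omega>)))"
      using assms(1) ij null_sets_diagonal
      unfolding continuous_family_def absolutely_continuous_def by blast
    then have "AE p in distr M borel (\<lambda>\<omega>. (X i \<omega>, X j \<omega>)). p \<notin> {p. fst p = snd p}"
      by (rule AE_not_in)
    then have "AE \<omega> in M. (X i \<omega>, X j \<omega>) \<notin> {p. fst p = snd p}"
      by (rule AE_distrD[rotated]) measurable
    then show ?thesis by simp
  qed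
  then have "AE \<omega> in M. \<forall>i\<in>I. \<forall>j\<in>I. i \<noteq> j \<longrightarrow> X i \<omega> \<noteq> X j \<omega>"
    using assms(2) by (auto intro!: AE_finite_allI)
  then show ?thesis by eventually_elim (auto simp: inj_on_def)
qed

section \<open>Level of the permutation test\<close>

text \<open>Formulated for any nonempty set of permutations closed under composition, so that both
  families are treated at once. Both bounds come from evaluating the expected number of rejecting
  permutations.\<close>

lemma perm_test_level:
  fixes q :: real
  assumes "prob_space M" and exch: "exchangeable_wrt M borel (T0 + Ts) P u"
    and P: "P \<subseteq> all_perms (T0 + Ts)" "P \<noteq> {}"
    and closed: "\<And>\<sigma> \<pi>. \<sigma> \<in> P \<Longrightarrow> \<pi> \<in> P \<Longrightarrow> \<sigma> \<circ> \<pi> \<in> P"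
    and u: "\<And>t. t \<in> {1..T0 + Ts} \<Longrightarrow> u t \<in> borel_measurable M"
    and \<alpha>: "0 \<le> \<alpha>" "\<alpha> \<le> 1"
  defines "p \<equiv> measure M {\<omega>\<in>space M. perm_pvalue P (test_stat T0 Ts q) (\<lambda>t. u t \<omega>) \<le> \<alpha>}"
  shows "p \<le> \<alpha>"
    and "continuous_family M P (\<lambda>\<pi> \<omega>. test_stat T0 Ts q ((\<lambda>t. u t \<omega>) \<circ> \<pi>))
      \<Longrightarrow> \<alpha> - 1 / real (card P) \<le> p"
proof -
  interpret prob_space M by fact
  let ?S = "test_stat T0 Ts q"
  let ?n = "real (card P)"
  define X where "X \<pi> \<omega> = ?S ((\<lambda>t. u t \<omega>) \<circ> \<pi>)" for \<pi> \<omega>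
  define A where "A \<omega> = {\<sigma>\<in>P. real (card {\<pi>\<in>P. X \<sigma> \<omega> \<le> X \<pi> \<omega>}) \<le> \<alpha> * ?n}" for \<omega>
  have fin: "finite P" using P(1) finite_all_perms finite_subset by blast
  then have n: "?n > 0" using P(2) by (simp add: card_gt_0_iff)
  have u_perm: "u (\<sigma> t) \<in> borel_measurable M" if "\<sigma> \<in> P" "t \<in> {1..T0 + Ts}" for \<sigma> t
    using that u all_perms_in_range P by blast
  let ?R = "\<lambda>\<sigma> \<omega>. perm_pvalue P ?S ((\<lambda>t. u t \<omega>) \<circ> \<sigma>) \<le> \<alpha>"
  have ev: "{\<omega>\<in>space M. ?R \<sigma> \<omega>} \<in> events" if "\<sigma> \<in> P" for \<sigma>
  proof -
    have [measurable]: "(\<lambda>\<omega>. perm_pvalue P ?S ((\<lambda>t. u t \<omega>) \<circ> \<sigma>)) \<in> borel_measurable M"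
      using u_perm[OF that] by (intro measurable_perm_pvalue[OF P(1)]) auto
    show ?thesis by measurable
  qed
  \<comment> \<open>The permutations whose p-value rejects are exactly those of low upper rank in
    the orbit.\<close>
  have A_eq: "{\<sigma>\<in>P. ?R \<sigma> \<omega>} = A \<omega>" for \<omega>
    unfolding A_def X_def
    using perm_pvalue_comp_le_iff[OF fin bij_betw_comp_left[OF P(1) closed]] by blast
  \<comment> \<open>Each summand equals \<open>p\<close> by exchangeability.\<close>
  have "?n * p = (\<Sum>\<sigma>\<in>P. prob {\<omega>\<in>space M. ?R \<sigma> \<omega>})"
    using prob_perm_pvalue_exchangeable[OF exch P(1) u] by (simp add: p_def cong: sum.cong)
  also have "\<dots> = expectation (\<lambda>\<omega>. real (card (A \<omega>)))"
    using sum_prob_eq_expectation_card(1)[OF fin, of ?R] ev by (simp add: A_eq)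
  finally have np: "?n * p = expectation (\<lambda>\<omega>. real (card (A \<omega>)))" .
  have int: "integrable M (\<lambda>\<omega>. real (card (A \<omega>)))"
    using sum_prob_eq_expectation_card(2)[OF fin, of ?R] ev by (simp add: A_eq)
  have "?n * p \<le> \<alpha> * ?n"
    unfolding np using int n \<alpha> unfolding A_def
    by (intro integral_le_const AE_I2 card_upper_rank_le[OF fin]) auto
  with n show "p \<le> \<alpha>" by (simp add: mult.commute)
  assume "continuous_family M P (\<lambda>\<pi> \<omega>. ?S ((\<lambda>t. u t \<omega>) \<circ> \<pi>))"
  moreover have "X \<pi> \<in> borel_measurable M" if "\<pi> \<in> P" for \<pi>
    unfolding X_def using u_perm[OF that] by (intro measurable_test_stat) simp
  ultimately have "AE \<omega> in M. inj_on (\<lambda>\<pi>. X \<pi> \<omega>) P"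
    unfolding X_def using fin by (intro continuous_family_AE_inj_on)
  then have "AE \<omega> in M. \<alpha> * ?n - 1 \<le> real (card (A \<omega>))"
  proof eventually_elim
    case (elim \<omega>)
    \<comment> \<open>The rank bound needs its threshold to be at most \<open>card P\<close>, which
      is where \<alpha> \<le> 1 enters.\<close>
    show ?case unfolding A_def
      using \<alpha> n by (intro card_upper_rank_ge[OF fin elim]) (auto simp: mult_left_le_one_le)
  qed
  then have "\<alpha> * ?n - 1 \<le> ?n * p"
    unfolding np using int by (intro integral_ge_const)
  with n show "\<alpha> - 1 / ?n \<le> p" by (simp add: field_simps)
qed

theorem theoremD1:
  fixes M :: "'w measure" and N :: "'z measure" and B :: "'b measure"
    and T T0 Ts :: nat and q \<alpha> :: real
    and Perms :: "(nat \<Rightarrow> nat) set"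
    and Z :: "nat \<Rightarrow> 'w \<Rightarrow> 'z" and \<beta> :: "(nat \<Rightarrow> 'z) \<Rightarrow> 'b"
    and g :: "'z \<times> 'b \<Rightarrow> real" and u :: "nat \<Rightarrow> 'w \<Rightarrow> real"
  assumes "prob_space M"
    and "T = T0 + Ts" and "Ts \<ge> 1" and "q \<ge> 1" and "0 < \<alpha>" and "\<alpha> < 1"
    and "Perms = moving_block_perms T \<or> Perms = all_perms T"
    and "\<And>t. t \<in> {1..T} \<Longrightarrow> Z t \<in> M \<rightarrow>\<^sub>M N"
    and "iid_sequence M N T Z \<or> exchangeable_wrt M N T Perms Z"
    and "\<beta> \<in> (\<Pi>\<^sub>M t\<in>{1..T}. N) \<rightarrow>\<^sub>M B"
    and "permutation_invariant N T \<beta>"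
    and "g \<in> borel_measurable (N \<Otimes>\<^sub>M B)"
    and "\<And>t \<omega>. t \<in> {1..T} \<Longrightarrow> \<omega> \<in> space M \<Longrightarrow> u t \<omega> = g (Z t \<omega>, \<beta> (trajectory T Z \<omega>))"
  shows "exchangeable_wrt M borel T Perms u
    \<and> measure M {\<omega> \<in> space M. perm_pvalue Perms (test_stat T0 Ts q) (\<lambda>t. u t \<omega>) \<le> \<alpha>} \<le> \<alpha>
    \<and> (continuous_family M Perms (\<lambda>\<pi> \<omega>. test_stat T0 Ts q ((\<lambda>t. u t \<omega>) \<circ> \<pi>)) \<longrightarrow>
         \<alpha> - 1 / real (card Perms)
           \<le> measure M {\<omega> \<in> space M. perm_pvalue Perms (test_stat T0 Ts q) (\<lambda>t. u t \<omega>) \<le> \<alpha>})"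
proof -
  \<comment> \<open>For \<open>T = 0\<close> the set of moving block permutations would be empty;
    positivity of \<open>Ts\<close> excludes this.\<close>
  have T: "T \<ge> 1" using \<open>T = T0 + Ts\<close> \<open>Ts \<ge> 1\<close> by simp
  have P: "Perms \<subseteq> all_perms T"
    using assms(7) moving_block_perms_subset by auto
  have ne: "Perms \<noteq> {}"
    using assms(7) T by (auto simp: moving_block_perms_def all_perms_def intro: permutes_id)
  have closed: "\<sigma> \<circ> \<pi> \<in> Perms" if "\<sigma> \<in> Perms" "\<pi> \<in> Perms" for \<sigma> \<pi>
    using assms(7) that moving_block_perms_comp_closed all_perms_comp_closed by blast
  \<comment> \<open>From here on the i.i.d. and the exchangeable case are one.\<close>
  have "exchangeable_wrt M N T Perms Z"
    using assms(9) iid_sequence_imp_exchangeable[where W = Z, OF assms(1) _ P assms(8)] by blast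
  then have exch: "exchangeable_wrt M borel T Perms u"
    using P assms(8,10,11,12,13) by (rule exchangeable_wrt_residuals)
  have u: "u t \<in> borel_measurable M" if t: "t \<in> {1..T}" for t
  proof -
    have "(\<lambda>\<omega>. g (Z t \<omega>, \<beta> (trajectory T Z \<omega>))) \<in> borel_measurable M"
      using assms(8)[OF t] measurable_compose[OF measurable_trajectory[OF assms(8)] assms(10)]
      by (intro measurable_compose[OF measurable_Pair assms(12)])
    then show ?thesis using assms(13)[OF t] by (simp cong: measurable_cong)
  qed
  show ?thesis
    using exch perm_test_level[OF assms(1) exch[unfolded assms(2)] P[unfolded assms(2)] ne closed
        u[unfolded assms(2)], of \<alpha> q] assms(5,6)
    by auto
qed

end
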